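(* Let $k\ge r\ge 2$ be integers and let $c\ge 0$ be a real number. Then the limit $g^k_{c,r}:=\lim_{n\to\infty} g_{c,r}(n,k)$ exists (as a finite real number).
   Context: An $r$-uniform hypergraph $H$ has a finite vertex set $V(H)$ and an edge set $E(H)$ consisting of $r$-element subsets of $V(H)$; $e(H)=|E(H)|$. A subgraph of $H$ is an $r$-uniform hypergraph $H'$ with $V(H')\subseteq V(H)$, $E(H')\subseteq E(H)$. $H$ is connected if for any $x,y\in V(H)$ there is a sequence $x=a_0,a_1,\dots,a_s=y$ of vertices such that each pair $\{a_{i-1},a_i\}$ is contained in a common edge. Deleting a set of vertices removes these vertices and every edge containing at least one of them. $H$ is $(k+1)$-connected if it has at least $k+2$ vertices and it remains connected after the deletion of any $k$ vertices. For real $c\ge 0$ and integers $r\ge 2$, $k\ge 1$, $\mathcal{F}_{c,r}(n,k)$ is the family of $n$-vertex $r$-uniform hypergraphs containing no $(k+1)$-connected subgraph on more than $ck+k$ vertices. The surplus is $$f_{c,r}(n,k)=\max_{H\in\mathcal{F}_{c,r}(n,k)}e(H)-\binom{n}{r}+\binom{n-k}{r},$$ and the relative surplus is, for $n>k$, $$g_{c,r}(n,k)=\frac{r!\cdot f_{c,r}(n,k)}{k^{r-1}(n-k)}.$$ *)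

theory Defs
  imports "HOL-Analysis.Analysis"
begin

record 'a hypergraph =
  verts :: "'a set"
  edges :: "'a set set"

definition uniform_hypergraph :: "nat \<Rightarrow> 'a hypergraph \<Rightarrow> bool" where
  "uniform_hypergraph r H \<longleftrightarrow>
     finite (verts H) \<and> (\<forall>e \<in> edges H. e \<subseteq> verts H \<and> card e = r)"

definition subgraph :: "nat \<Rightarrow> 'a hypergraph \<Rightarrow> 'a hypergraph \<Rightarrow> bool" where
  "subgraph r H' H \<longleftrightarrow>
     uniform_hypergraph r H' \<and> verts H' \<subseteq> verts H \<and> edges H' \<subseteq> edges H"

definition connected_hypergraph :: "'a hypergraph \<Rightarrow> bool" where
  "connected_hypergraph H \<longleftrightarrow>
     (\<forall>x \<in> verts H. \<forall>y \<in> verts H. \<exists>(a :: nat \<Rightarrow> 'a) s.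
        a 0 = x \<and> a s = y \<and> (\<forall>i \<le> s. a i \<in> verts H) \<and>
        (\<forall>i < s. \<exists>e \<in> edges H. {a i, a (Suc i)} \<subseteq> e))"

definition delete_verts :: "'a set \<Rightarrow> 'a hypergraph \<Rightarrow> 'a hypergraph" where
  "delete_verts S H =
     \<lparr>verts = verts H - S, edges = {e \<in> edges H. e \<inter> S = {}}\<rparr>"

text \<open>The parameter is the number \<open>k\<close> of deleted vertices: \<open>Suc_connected k H\<close> is
  \<open>(k+1)\<close>-connectivity of \<open>H\<close>.\<close>

definition Suc_connected :: "nat \<Rightarrow> 'a hypergraph \<Rightarrow> bool" where
  "Suc_connected k H \<longleftrightarrow>
     card (verts H) \<ge> k + 2 \<and>
     (\<forall>S. S \<subseteq> verts H \<and> card S = k \<longrightarrow> connected_hypergraph (delete_verts S H))"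

text \<open>Taking vertices in \<open>nat\<close> loses nothing, since every finite hypergraph is isomorphic to
  one with such vertices.\<close>

definition family :: "real \<Rightarrow> nat \<Rightarrow> nat \<Rightarrow> nat \<Rightarrow> nat hypergraph set" where
  "family c r n k =
     {H. uniform_hypergraph r H \<and> card (verts H) = n \<and>
         \<not> (\<exists>H'. subgraph r H' H \<and> Suc_connected k H' \<and>
                 real (card (verts H')) > c * real k + real k)}"

definition surplus :: "real \<Rightarrow> nat \<Rightarrow> nat \<Rightarrow> nat \<Rightarrow> real" where
  "surplus c r n k =
     real (Max ((\<lambda>H. card (edges H)) ` family c r n k))
       - real (n choose r) + real ((n - k) choose r)"

text \<open>Only meaningful for \<open>n > k\<close>.\<close>

definition relative_surplus :: "real \<Rightarrow> nat \<Rightarrow> nat \<Rightarrow> nat \<Rightarrow> real" where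
  "relative_surplus c r n k =
     fact r * surplus c r n k / (real k ^ (r - 1) * (real n - real k))"

text \<open>The maximum in \<^const>\<open>surplus\<close> is over a finite nonempty set of numbers, although
  \<^const>\<open>family\<close> itself is infinite for \<open>n > 0\<close>.\<close>

lemma finite_edge_counts: "finite ((\<lambda>H. card (edges H)) ` family c r n k)"
proof (rule finite_subset)
  show "(\<lambda>H. card (edges H)) ` family c r n k \<subseteq> {..n choose r}"
  proof (rule image_subsetI)
    fix H assume "H \<in> family c r n k"
    then have fin: "finite (verts H)" and n: "card (verts H) = n"
      and sub: "edges H \<subseteq> {e. e \<subseteq> verts H \<and> card e = r}"
      by (auto simp: family_def uniform_hypergraph_def)
    have "finite {e. e \<subseteq> verts H \<and> card e = r}"
      using fin by simp
    then have "card (edges H) \<le> card {e. e \<subseteq> verts H \<and> card e = r}"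
      using sub by (rule card_mono)
    then show "card (edges H) \<in> {..n choose r}"
      using n_subsets[OF fin, of r] n by simp
  qed
qed simp

lemma family_nonempty: "family c r n k \<noteq> {}"
proof -
  define H where "H = \<lparr>verts = {..<n}, edges = {} :: nat set set\<rparr>"
  have "\<not> Suc_connected k H'" if "subgraph r H' H" for H'
  proof
    assume conn: "Suc_connected k H'"
    have E: "edges H' = {}"
      using that by (auto simp: subgraph_def H_def)
    have big: "card (verts H') \<ge> k + 2"
      using conn by (simp add: Suc_connected_def)
    then obtain S where S: "S \<subseteq> verts H'" "card S = k" "finite S"
      by (rule obtain_subset_with_card_n[OF add_leD1])
    have "\<not> card (verts H' - S) \<le> 1"
      using big S by (simp add: card_Diff_subset)
    moreover have "finite (verts H' - S)"
      using that by (simp add: subgraph_def uniform_hypergraph_def)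
    ultimately obtain x y where xy: "x \<in> verts H' - S" "y \<in> verts H' - S" "x \<noteq> y"
      by (auto simp: card_le_Suc0_iff_eq)
    have conn': "connected_hypergraph (delete_verts S H')"
      using conn S by (simp add: Suc_connected_def)
    have xy': "x \<in> verts (delete_verts S H')" "y \<in> verts (delete_verts S H')"
      using xy by (simp_all add: delete_verts_def)
    obtain a :: "nat \<Rightarrow> nat" and s where "a 0 = x" "a s = y"
      and "\<forall>i < s. \<exists>e \<in> edges (delete_verts S H'). {a i, a (Suc i)} \<subseteq> e"
      using conn'[unfolded connected_hypergraph_def, rule_format, OF xy'] by metis
    then show False
      using xy(3) E by (cases s) (auto simp: delete_verts_def)
  qed
  then have "H \<in> family c r n k"
    by (auto simp: family_def uniform_hypergraph_def H_def)
  then show ?thesis by blast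
qed

end

theory Submission
  imports Defs
begin

text \<open>
  Since \<open>(n choose r) - e(H)\<close> counts the \<open>r\<close>-sets of vertices that are not edges, the surplus at
  \<open>n = m + k\<close> is \<open>F(m) = (m choose r) - N(m)\<close>, where \<open>N(m)\<close> is the least number of non-edges.
  Gluing extremal hypergraphs for \<open>a\<close> and \<open>b\<close> along \<open>k\<close> common vertices, and declaring every
  \<open>r\<close>-set that meets the common part and both sides an edge, creates no new highly connected
  subgraph, so \<open>F\<close> is superadditive. Conversely, for \<open>m > ck\<close> an extremal hypergraph has a
  separator of \<open>k\<close> vertices. Splitting there counts twice only non-edges inside the separator, so
  \<open>F(m) \<le> F(a) + F(b) + (k choose r)\<close> for some \<open>a + b = m\<close>. Hence \<open>F\<close> grows at most linearly,
  and Fekete's lemma gives the limit of \<open>F(m) / m\<close>.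
\<close>

section \<open>Fekete's lemma for superadditive sequences\<close>

text \<open>The limit is the supremum \<open>L\<close> of the quotients, finite by the linear bound.
  If \<open>m\<close> has quotient above \<open>x < L\<close>, cutting a large \<open>n\<close> into
  blocks of length \<open>m\<close> and one bounded remainder keeps the quotient of \<open>n\<close>
  above \<open>x\<close>.\<close>

lemma convergent_superadditive_div:
  fixes f :: "nat \<Rightarrow> real"
  assumes super: "\<And>m n. 1 \<le> m \<Longrightarrow> 1 \<le> n \<Longrightarrow> f m + f n \<le> f (m + n)"
    and bound: "\<And>n. 1 \<le> n \<Longrightarrow> f n \<le> D * real n"
  shows "convergent (\<lambda>n. f n / real n)"
proof -
  define L where "L = (SUP n\<in>{1..}. f n / real n)"
  have bdd: "bdd_above ((\<lambda>n. f n / real n) ` {1..})"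
    using bound by (intro bdd_aboveI2[where M = D]) (simp add: field_simps)
  have upper: "f n / real n \<le> L" if "1 \<le> n" for n
    unfolding L_def using bdd that by (intro cSUP_upper) auto
  have mult: "real q * f m + f t \<le> f (q * m + t)" if "1 \<le> m" "1 \<le> t" for m t q
  proof (induction q)
    case (Suc q)
    have "f m + f (q * m + t) \<le> f (m + (q * m + t))"
      using that by (intro super) auto
    then show ?case using Suc by (simp add: algebra_simps)
  qed simp
  have "(\<lambda>n. f n / real n) \<longlonglongrightarrow> L"
  proof (rule order_tendstoI)
    fix x assume "L < x"
    then show "\<forall>\<^sub>F n in sequentially. f n / real n < x"
      using upper by (intro eventually_sequentiallyI[of 1]) (meson le_less_trans)
  next
    fix x assume "x < L"
    then obtain m where m: "1 \<le> m" "x < f m / real m"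
      unfolding L_def using bdd by (auto simp: less_cSUP_iff)
    \<comment> \<open>Least excess over the line of slope \<open>x\<close> that a remainder can
      have.\<close>
    define C where "C = Min ((\<lambda>t. f t - x * real t) ` {1..m})"
    have C: "C \<le> f t - x * real t" if "t \<in> {1..m}" for t
      unfolding C_def using that by (intro Min_le) auto
    \<comment> \<open>Each block of length \<open>m\<close> gains \<open>d\<close> over slope
      \<open>x\<close>, so \<open>q0\<close> blocks outweigh even a negative
      \<open>C\<close>.\<close>
    define d where "d = f m - x * real m"
    have d: "0 < d" using m by (simp add: d_def field_simps)
    obtain q0 :: nat where q0: "- C < real q0 * d"
      using ex_less_of_nat_mult[OF d] by blast
    show "\<forall>\<^sub>F n in sequentially. x < f n / real n"
    proof (rule eventually_sequentiallyI)
      fix n assume n: "q0 * m + 1 \<le> n"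
      define q where "q = (n - 1) div m"
      \<comment> \<open>The shift by one puts the remainder in \<open>{1..m}\<close> instead of
        \<open>{0..m-1}\<close>: superadditivity is given for positive arguments only.\<close>
      define t where "t = (n - 1) mod m + 1"
      have n_eq: "n = q * m + t" unfolding q_def t_def using n by simp
      have t: "t \<in> {1..m}" using m unfolding t_def by (auto simp: Suc_le_eq)
      have "q0 \<le> q" unfolding q_def using n m
        by (metis Nat.le_diff_conv2 add_leD2 div_le_mono nonzero_mult_div_cancel_right not_one_le_zero)
      then have "real q0 * d \<le> real q * d" using d by simp
      then have "0 < real q * d + C" using q0 by simp
      also have "\<dots> \<le> real q * d + (f t - x * real t)" using C[OF t] by simp
      also have "\<dots> = real q * f m + f t - x * real n"
        by (simp add: d_def n_eq algebra_simps)
      also have "\<dots> \<le> f n - x * real n" using mult[of m t q] m t n_eq by simp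
      finally show "x < f n / real n" using n by (simp add: field_simps)
    qed
  qed
  then show ?thesis by (rule convergentI)
qed

section \<open>Connectivity in terms of separators\<close>

text \<open>Edges meeting \<open>S\<close> are unrestricted because they vanish when
  \<open>S\<close> is deleted. \<open>A\<close> and \<open>B\<close> may be unions of several
  components, and \<open>S = {}\<close> describes a disconnection of \<open>H\<close>
  itself.\<close>

definition separates :: "'a hypergraph \<Rightarrow> 'a set \<Rightarrow> 'a set \<Rightarrow> 'a set \<Rightarrow> bool" where
  "separates H S A B \<longleftrightarrow>
     verts H = S \<union> A \<union> B \<and> S \<inter> A = {} \<and> S \<inter> B = {} \<and> A \<inter> B = {} \<and> A \<noteq> {} \<and> B \<noteq> {} \<and>
     (\<forall>e \<in> edges H. e \<inter> S = {} \<longrightarrow> e \<subseteq> A \<or> e \<subseteq> B)"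

text \<open>A path that starts in \<open>A\<close> cannot leave it, as every edge stays on one side.
  Conversely, the set of vertices reachable from \<open>x\<close> is closed under edges, so it and
  its complement form a separation unless it is everything.\<close>

lemma connected_hypergraph_iff:
  assumes sub: "\<And>e. e \<in> edges H \<Longrightarrow> e \<subseteq> verts H"
  shows "connected_hypergraph H \<longleftrightarrow> \<not> (\<exists>A B. separates H {} A B)"
proof
  assume conn: "connected_hypergraph H"
  show "\<not> (\<exists>A B. separates H {} A B)"
  proof
    assume "\<exists>A B. separates H {} A B"
    then obtain A B where "separates H {} A B" by blast
    then have AB: "verts H = A \<union> B" "A \<inter> B = {}" "A \<noteq> {}" "B \<noteq> {}"
        "\<And>e. e \<in> edges H \<Longrightarrow> e \<subseteq> A \<or> e \<subseteq> B"
      by (auto simp: separates_def)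
    then obtain x y where xy: "x \<in> A" "y \<in> B" by auto
    have "\<exists>a s. a 0 = x \<and> a s = y \<and> (\<forall>i \<le> (s :: nat). a i \<in> verts H) \<and>
        (\<forall>i < s. \<exists>e \<in> edges H. {a i, a (Suc i)} \<subseteq> e)"
      using conn xy AB(1) unfolding connected_hypergraph_def by blast
    then obtain a s where a: "a 0 = x" "a s = y"
        "\<And>i. i < s \<Longrightarrow> \<exists>e \<in> edges H. {a i, a (Suc i)} \<subseteq> e"
      by auto
    have "i \<le> s \<Longrightarrow> a i \<in> A" for i
    proof (induction i)
      case (Suc i)
      then obtain e where "e \<in> edges H" "{a i, a (Suc i)} \<subseteq> e" "a i \<in> A"
        using a(3)[of i] by auto
      then show ?case using AB(2) AB(5)[of e] by blast
    qed (use a xy in simp)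
    then show False using a(2) xy AB(2) by blast
  qed
next
  assume nosep: "\<not> (\<exists>A B. separates H {} A B)"
  show "connected_hypergraph H"
    unfolding connected_hypergraph_def
  proof (intro ballI)
    fix x y assume x: "x \<in> verts H" and y: "y \<in> verts H"
    define path where "path z a s \<longleftrightarrow> a 0 = x \<and> a s = z \<and> (\<forall>i \<le> s. a i \<in> verts H) \<and>
        (\<forall>i < s. \<exists>e \<in> edges H. {a i, a (Suc i)} \<subseteq> e)" for z and a :: "nat \<Rightarrow> 'a" and s
    define R where "R = {z. \<exists>a s. path z a s}"
    have "path x (\<lambda>_. x) 0" using x by (simp add: path_def)
    then have xR: "x \<in> R" unfolding R_def by blast
    have RV: "R \<subseteq> verts H" unfolding R_def path_def by auto
    have closed: "v \<in> R" if e: "e \<in> edges H" and uv: "u \<in> e" "u \<in> R" "v \<in> e" for e u v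
    proof -
      obtain a s where a: "path u a s" using uv(2) by (auto simp: R_def)
      have "path v (a(Suc s := v)) (Suc s)"
        using a e uv sub[OF e] unfolding path_def by (auto simp: le_Suc_eq less_Suc_eq)
      then show ?thesis unfolding R_def by blast
    qed
    have "e \<subseteq> R \<or> e \<subseteq> verts H - R" if "e \<in> edges H" for e
      using sub[OF that] closed[OF that] by blast
    then have "separates H {} R (verts H - R)" if "verts H - R \<noteq> {}"
      unfolding separates_def using that RV xR by blast
    then have "verts H - R = {}" using nosep by blast
    then have "y \<in> R" using y by blast
    then show "\<exists>a s. a 0 = x \<and> a s = y \<and> (\<forall>i \<le> (s :: nat). a i \<in> verts H) \<and>
        (\<forall>i < s. \<exists>e \<in> edges H. {a i, a (Suc i)} \<subseteq> e)"
      by (auto simp: R_def path_def)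
  qed
qed

text \<open>A disconnection of the hypergraph left after deleting \<open>S\<close> is the same as a
  separation of \<open>H\<close> by \<open>S\<close>. This form avoids both paths and deletion in
  everything that follows.\<close>

lemma Suc_connected_iff:
  assumes "uniform_hypergraph r H"
  shows "Suc_connected k H \<longleftrightarrow>
    k + 2 \<le> card (verts H) \<and> \<not> (\<exists>S A B. card S = k \<and> separates H S A B)"
proof -
  have "connected_hypergraph (delete_verts S H) \<longleftrightarrow> \<not> (\<exists>A B. separates H S A B)"
    if "S \<subseteq> verts H" for S
  proof -
    have "separates (delete_verts S H) {} A B \<longleftrightarrow> separates H S A B" for A B
    proof -
      have "verts H - S = A \<union> B \<longleftrightarrow> verts H = S \<union> A \<union> B" if "S \<inter> A = {}" "S \<inter> B = {}"
        using \<open>S \<subseteq> verts H\<close> that by blast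
      moreover have "S \<inter> A = {} \<and> S \<inter> B = {}" if "verts H - S = A \<union> B"
        using that by blast
      ultimately show ?thesis unfolding separates_def delete_verts_def by auto
    qed
    moreover have "e \<subseteq> verts (delete_verts S H)" if "e \<in> edges (delete_verts S H)" for e
      using that assms unfolding delete_verts_def uniform_hypergraph_def by auto
    ultimately show ?thesis by (simp add: connected_hypergraph_iff)
  qed
  moreover have "S \<subseteq> verts H" if "separates H S A B" for S A B
    using that unfolding separates_def by auto
  ultimately show ?thesis unfolding Suc_connected_def by metis
qed

text \<open>Enlarging the separator inside the subgraph to exactly \<open>k\<close> vertices, while keeping one
  vertex on either side, would separate the subgraph.\<close>

lemma Suc_connected_subgraph_side:
  assumes sub: "subgraph r H' H" and conn: "Suc_connected k H'"
    and sep: "separates H S A B" and S: "card S = k" "finite S"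
  shows "verts H' \<subseteq> S \<union> A \<or> verts H' \<subseteq> S \<union> B"
proof (rule ccontr)
  assume not_side: "\<not> ?thesis"
  have V: "verts H = S \<union> A \<union> B" and disj: "S \<inter> A = {}" "S \<inter> B = {}" "A \<inter> B = {}"
    and cross: "\<And>e. e \<in> edges H \<Longrightarrow> e \<inter> S = {} \<Longrightarrow> e \<subseteq> A \<or> e \<subseteq> B"
    using sep by (auto simp: separates_def)
  have V': "verts H' \<subseteq> S \<union> A \<union> B" using sub V by (simp add: subgraph_def)
  then obtain x y where xy: "x \<in> verts H'" "x \<in> A" "y \<in> verts H'" "y \<in> B"
    using not_side by blast
  have U: "uniform_hypergraph r H'" using sub by (simp add: subgraph_def)
  have fin: "finite (verts H')" using U by (simp add: uniform_hypergraph_def)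
  have card: "k + 2 \<le> card (verts H')" using conn by (simp add: Suc_connected_def)
  \<comment> \<open>The size condition \<open>k + 2\<close> leaves at least \<open>k\<close>
    vertices besides \<open>x\<close> and \<open>y\<close>, which is the room needed for
    \<open>T\<close>.\<close>
  have "card {x, y} \<le> 2" by (simp add: card_insert_if)
  then have "k \<le> card (verts H' - {x, y})"
    using card xy fin by (simp add: card_Diff_subset)
  moreover have "S \<inter> verts H' \<subseteq> verts H' - {x, y}"
    using xy disj by blast
  moreover have "card (S \<inter> verts H') \<le> k" using S by (metis Int_lower1 card_mono)
  ultimately obtain T where T: "S \<inter> verts H' \<subseteq> T" "T \<subseteq> verts H' - {x, y}" "card T = k"
    using fin by (meson exists_subset_between finite_Diff)
  have "separates H' T (verts H' \<inter> A - T) (verts H' \<inter> B - T)"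
    unfolding separates_def
  proof (intro conjI ballI impI)
    fix e assume e: "e \<in> edges H'" "e \<inter> T = {}"
    then have "e \<subseteq> verts H'" using U by (auto simp: uniform_hypergraph_def)
    moreover have "e \<in> edges H" using e sub by (auto simp: subgraph_def)
    moreover have "e \<inter> S = {}" using e T(1) \<open>e \<subseteq> verts H'\<close> by blast
    ultimately show "e \<subseteq> verts H' \<inter> A - T \<or> e \<subseteq> verts H' \<inter> B - T"
      using cross[of e] e(2) by blast
  next
    show "verts H' = T \<union> (verts H' \<inter> A - T) \<union> (verts H' \<inter> B - T)"
      using T(1,2) V' by blast
    show "verts H' \<inter> A - T \<noteq> {}" "verts H' \<inter> B - T \<noteq> {}"
      using T(2) xy by blast+
  qed (use disj in blast)+
  then show False using conn T(3) unfolding Suc_connected_iff[OF U] by blast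
qed

section \<open>Invariance under renaming vertices\<close>

text \<open>An isomorphic copy when \<open>f\<close> is injective on the vertices. Gluing needs
  extremal hypergraphs on prescribed vertex sets, and this moves them there.\<close>

definition relabel :: "('a \<Rightarrow> 'b) \<Rightarrow> 'a hypergraph \<Rightarrow> 'b hypergraph" where
  "relabel f H = \<lparr>verts = f ` verts H, edges = (`) f ` edges H\<rparr>"

lemma uniform_relabel:
  assumes "uniform_hypergraph r H" "inj_on f (verts H)"
  shows "uniform_hypergraph r (relabel f H)"
  using assms unfolding uniform_hypergraph_def relabel_def
  by (auto intro!: card_image inj_on_subset[of f "verts H"])

text \<open>A separation of the copy pulls back along \<open>f\<close> to one of \<open>H\<close>;
  injectivity ensures that the pulled-back separator still has \<open>k\<close> vertices.\<close>

lemma Suc_connected_relabel: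
  assumes U: "uniform_hypergraph r H" and inj: "inj_on f (verts H)" and conn: "Suc_connected k H"
  shows "Suc_connected k (relabel f H)"
proof -
  have "\<not> separates (relabel f H) S A B" if "card S = k" for S A B
  proof
    assume sep: "separates (relabel f H) S A B"
    let ?p = "\<lambda>X. f -` X \<inter> verts H"
    have V: "f ` verts H = S \<union> A \<union> B"
      and disj: "S \<inter> A = {}" "S \<inter> B = {}" "A \<inter> B = {}" "A \<noteq> {}" "B \<noteq> {}"
      using sep by (auto simp: separates_def relabel_def)
    have image: "f ` ?p X = X" if "X \<subseteq> f ` verts H" for X
      using that by auto
    have sub: "S \<subseteq> f ` verts H" "A \<subseteq> f ` verts H" "B \<subseteq> f ` verts H"
      unfolding V by auto
    have mem: "f v \<in> S \<union> A \<union> B" if "v \<in> verts H" for v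
      using that V by blast
    have "f ` ?p S = S" using sub(1) by (rule image)
    moreover have "inj_on f (?p S)" using inj by (rule inj_on_subset) blast
    ultimately have "card (?p S) = k" using that by (metis card_image)
    moreover have "separates H (?p S) (?p A) (?p B)"
      unfolding separates_def
    proof (intro conjI ballI impI)
      fix e assume e: "e \<in> edges H" "e \<inter> ?p S = {}"
      then have "e \<subseteq> verts H" using U by (auto simp: uniform_hypergraph_def)
      moreover have "f ` e \<inter> S = {}" using e \<open>e \<subseteq> verts H\<close> by blast
      moreover have "f ` e \<in> edges (relabel f H)" using e by (simp add: relabel_def)
      ultimately have "f ` e \<subseteq> A \<or> f ` e \<subseteq> B"
        using sep unfolding separates_def by meson
      then show "e \<subseteq> ?p A \<or> e \<subseteq> ?p B"
        using \<open>e \<subseteq> verts H\<close> by auto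
    next
      show "verts H = ?p S \<union> ?p A \<union> ?p B" using mem by auto
      show "?p A \<noteq> {}" "?p B \<noteq> {}"
        using image[OF sub(2)] image[OF sub(3)] disj(4,5) by (metis image_empty)+
    qed (use disj in blast)+
    ultimately show False using conn unfolding Suc_connected_iff[OF U] by blast
  qed
  then show ?thesis
    using conn unfolding Suc_connected_iff[OF U] Suc_connected_iff[OF uniform_relabel[OF U inj]]
    by (simp add: relabel_def card_image[OF inj])
qed

lemma family_subgraph:
  assumes "H \<in> family c r n k" "subgraph r H' H"
  shows "H' \<in> family c r (card (verts H')) k"
  using assms unfolding family_def subgraph_def by blast

text \<open>The inverse of \<open>f\<close> carries a forbidden subgraph of the copy back to one of
  \<open>H\<close> with equally many vertices.\<close>

lemma family_relabel:
  assumes H: "H \<in> family c r n k" and inj: "inj_on f (verts H)"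
  shows "relabel f H \<in> family c r n k"
proof -
  have U: "uniform_hypergraph r H" using H by (simp add: family_def)
  let ?g = "inv_into (verts H) f"
  have "\<not> Suc_connected k H'"
    if sub: "subgraph r H' (relabel f H)" and big: "real (card (verts H')) > c * real k + real k" for H'
  proof
    assume conn: "Suc_connected k H'"
    have U': "uniform_hypergraph r H'" and V': "verts H' \<subseteq> f ` verts H"
      and E': "edges H' \<subseteq> (`) f ` edges H"
      using sub by (auto simp: subgraph_def relabel_def)
    have ginj: "inj_on ?g (verts H')" using V' by (rule inj_on_inv_into)
    have "edges (relabel ?g H') \<subseteq> edges H"
    proof
      fix e assume "e \<in> edges (relabel ?g H')"
      then obtain d where d: "d \<in> edges H" "e = ?g ` f ` d"
        using E' by (auto simp: relabel_def)
      moreover have "d \<subseteq> verts H" using d U by (auto simp: uniform_hypergraph_def)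
      ultimately show "e \<in> edges H" using inj by (simp add: inv_into_image_cancel)
    qed
    moreover have "verts (relabel ?g H') \<subseteq> verts H"
      using V' by (auto simp: relabel_def intro!: inv_into_into)
    ultimately have "subgraph r (relabel ?g H') H"
      using uniform_relabel[OF U' ginj] by (simp add: subgraph_def)
    moreover have "card (verts (relabel ?g H')) = card (verts H')"
      using ginj by (simp add: relabel_def card_image)
    ultimately show False
      using H big Suc_connected_relabel[OF U' ginj conn] unfolding family_def by auto
  qed
  then show ?thesis
    using H uniform_relabel[OF U inj] card_image[OF inj]
    by (auto simp: family_def relabel_def)
qed

section \<open>The surplus in terms of non-edges\<close>

definition rsets :: "nat \<Rightarrow> 'a set \<Rightarrow> 'a set set" where
  "rsets r V = {e. e \<subseteq> V \<and> card e = r}"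

lemma finite_rsets: "finite V \<Longrightarrow> finite (rsets r V)"
  by (simp add: rsets_def)

lemma card_rsets: "finite V \<Longrightarrow> card (rsets r V) = card V choose r"
  by (simp add: rsets_def n_subsets)

definition nonedges :: "nat \<Rightarrow> 'a hypergraph \<Rightarrow> 'a set set" where
  "nonedges r H = rsets r (verts H) - edges H"

lemma card_edges_nonedges:
  assumes "uniform_hypergraph r H"
  shows "card (edges H) + card (nonedges r H) = card (verts H) choose r"
proof -
  have fin: "finite (verts H)" using assms by (simp add: uniform_hypergraph_def)
  have sub: "edges H \<subseteq> rsets r (verts H)"
    using assms by (auto simp: uniform_hypergraph_def rsets_def)
  then have "card (edges H) \<le> card (rsets r (verts H))"
    using fin by (intro card_mono finite_rsets)
  moreover have "card (nonedges r H) = card (rsets r (verts H)) - card (edges H)"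
    unfolding nonedges_def using sub fin by (metis card_Diff_subset finite_rsets finite_subset)
  ultimately show ?thesis using fin by (simp add: card_rsets)
qed

text \<open>Edges and non-edges together number \<open>n choose r\<close>, so this binomial cancels
  in the surplus, and an upper bound on non-edges becomes a lower bound on the surplus. Equality for
  an extremal hypergraph is \<open>surplus_attained\<close>.\<close>

lemma surplus_ge:
  assumes "H \<in> family c r n k"
  shows "real ((n - k) choose r) - real (card (nonedges r H)) \<le> surplus c r n k"
proof -
  have "uniform_hypergraph r H" "card (verts H) = n" using assms by (auto simp: family_def)
  then have "real (card (edges H)) + real (card (nonedges r H)) = real (n choose r)"
    using card_edges_nonedges by (metis of_nat_add)
  moreover have "card (edges H) \<le> Max ((\<lambda>H. card (edges H)) ` family c r n k)"
    using assms finite_edge_counts by (intro Max_ge) auto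
  ultimately show ?thesis unfolding surplus_def by linarith
qed

lemma surplus_attained:
  obtains H where "H \<in> family c r n k"
    and "surplus c r n k = real ((n - k) choose r) - real (card (nonedges r H))"
proof -
  have "Max ((\<lambda>H. card (edges H)) ` family c r n k) \<in> (\<lambda>H. card (edges H)) ` family c r n k"
    using finite_edge_counts family_nonempty by (intro Max_in) auto
  then obtain H where H: "H \<in> family c r n k"
    "Max ((\<lambda>H. card (edges H)) ` family c r n k) = card (edges H)" by auto
  have "uniform_hypergraph r H" "card (verts H) = n" using H(1) by (auto simp: family_def)
  then have "real (card (edges H)) + real (card (nonedges r H)) = real (n choose r)"
    using card_edges_nonedges by (metis of_nat_add)
  then show ?thesis using that[OF H(1)] H(2) by (simp add: surplus_def)
qed

section \<open>Gluing and superadditivity\<close>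

text \<open>If \<open>S\<close> separates \<open>A\<close> from \<open>B\<close>, these are the sets
  that the separation forces to be non-edges.\<close>

definition crossing :: "nat \<Rightarrow> 'a set \<Rightarrow> 'a set \<Rightarrow> 'a set set" where
  "crossing r A B = rsets r (A \<union> B) - (rsets r A \<union> rsets r B)"

text \<open>Only the empty set could lie in both \<open>rsets r A\<close> and
  \<open>rsets r B\<close>, and \<open>0 < r\<close> excludes it. The identity makes the binomials
  cancel exactly in both gluing and splitting.\<close>

lemma card_crossing:
  assumes "finite A" "finite B" "A \<inter> B = {}" "0 < r"
  shows "card (crossing r A B) + (card A choose r) + (card B choose r) = (card A + card B) choose r"
proof -
  have disj: "rsets r A \<inter> rsets r B = {}"
  proof -
    have "card e = 0" if "e \<in> rsets r A" "e \<in> rsets r B" for e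
      using that assms(3) by (metis Int_subset_iff card.empty mem_Collect_eq rsets_def subset_empty)
    then show ?thesis using assms(4) by (auto simp: rsets_def)
  qed
  have sub: "rsets r A \<union> rsets r B \<subseteq> rsets r (A \<union> B)" by (auto simp: rsets_def)
  have c: "card (rsets r A \<union> rsets r B) = (card A choose r) + (card B choose r)"
    using assms disj by (simp add: card_Un_disjoint finite_rsets card_rsets)
  have "card (rsets r (A \<union> B)) = (card A + card B) choose r"
    using assms by (simp add: card_rsets card_Un_disjoint)
  moreover have "card (rsets r A \<union> rsets r B) \<le> card (rsets r (A \<union> B))"
    using sub assms by (intro card_mono finite_rsets) auto
  moreover have "card (crossing r A B) = card (rsets r (A \<union> B)) - card (rsets r A \<union> rsets r B)"
    unfolding crossing_def using sub assms by (intro card_Diff_subset) (auto intro: finite_rsets)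
  ultimately show ?thesis using c by linarith
qed

text \<open>A highly connected subgraph of the glued hypergraph lies on one side of the separator
  \<open>S\<close>, hence in one of the two pieces. The non-edges are at most those of the pieces
  plus the crossing sets.\<close>

lemma surplus_superadditive:
  assumes "0 < r" "1 \<le> a" "1 \<le> b"
  shows "surplus c r (a + k) k + surplus c r (b + k) k \<le> surplus c r (a + b + k) k"
proof -
  define S A B where "S = {..<k}" and "A = {k..<k + a}" and "B = {k + a..<k + a + b}"
  have fin: "finite S" "finite A" "finite B" and card: "card S = k" "card A = a" "card B = b"
    and disj: "S \<inter> A = {}" "S \<inter> B = {}" "A \<inter> B = {}"
    by (auto simp: S_def A_def B_def)
  \<comment> \<open>Extremal hypergraphs can be placed on any vertex set of the right size, so the
    two pieces can be made to share exactly \<open>S\<close>.\<close>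
  have ex: "\<exists>H \<in> family c r (d + k) k. verts H = S \<union> D \<and>
      surplus c r (d + k) k = real (d choose r) - real (card (nonedges r H))"
    if D: "finite D" "card D = d" "S \<inter> D = {}" for D d
  proof -
    obtain H where H: "H \<in> family c r (d + k) k"
      "surplus c r (d + k) k = real ((d + k - k) choose r) - real (card (nonedges r H))"
      by (rule surplus_attained)
    have U: "uniform_hypergraph r H" and cV: "card (verts H) = d + k"
      using H(1) by (auto simp: family_def)
    then have "finite (verts H)" by (simp add: uniform_hypergraph_def)
    moreover have cD: "card (S \<union> D) = d + k" using D fin card by (simp add: card_Un_disjoint)
    ultimately obtain f where f: "bij_betw f (verts H) (S \<union> D)"
      using cV D fin by (metis finite_Un finite_same_card_bij)
    then have inj: "inj_on f (verts H)" and im: "verts (relabel f H) = S \<union> D"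
      by (auto simp: bij_betw_def relabel_def)
    have "card (edges (relabel f H)) = card (edges H)"
    proof -
      have "inj_on ((`) f) (edges H)"
        using inj_on_image_Pow[OF inj] U
        by (auto simp: uniform_hypergraph_def intro: inj_on_subset)
      then show ?thesis by (simp add: relabel_def card_image)
    qed
    then have "card (nonedges r (relabel f H)) = card (nonedges r H)"
      using card_edges_nonedges[OF U] card_edges_nonedges[OF uniform_relabel[OF U inj]] im cD cV
      by simp
    then show ?thesis
      using H(2) im family_relabel[OF H(1) inj] by (intro bexI[of _ "relabel f H"]) auto
  qed
  obtain H1 where H1: "H1 \<in> family c r (a + k) k" "verts H1 = S \<union> A"
    "surplus c r (a + k) k = real (a choose r) - real (card (nonedges r H1))"
    using ex[of A a] fin card disj by auto
  obtain H2 where H2: "H2 \<in> family c r (b + k) k" "verts H2 = S \<union> B"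
    "surplus c r (b + k) k = real (b choose r) - real (card (nonedges r H2))"
    using ex[of B b] fin card disj by auto
  \<comment> \<open>A set inside \<open>S\<close> becomes an edge only if it is one in both pieces.
    A set meeting \<open>S\<close>, \<open>A\<close> and \<open>B\<close> belongs to none of the
    three parts and becomes an edge.\<close>
  define N where "N = nonedges r H1 \<union> nonedges r H2 \<union> crossing r A B"
  define H where "H = \<lparr>verts = S \<union> A \<union> B, edges = rsets r (S \<union> A \<union> B) - N\<rparr>"
  have U: "uniform_hypergraph r H"
    using fin by (auto simp: uniform_hypergraph_def H_def rsets_def)
  have sep: "separates H S A B"
    unfolding separates_def
  proof (intro conjI ballI impI)
    fix e assume e: "e \<in> edges H" "e \<inter> S = {}"
    then have "e \<subseteq> A \<union> B" "card e = r" "e \<notin> crossing r A B"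
      by (auto simp: H_def N_def rsets_def)
    then show "e \<subseteq> A \<or> e \<subseteq> B" by (auto simp: crossing_def rsets_def)
  qed (use disj card assms in \<open>auto simp: H_def\<close>)
  have "H \<in> family c r (a + b + k) k"
  proof -
    have "\<not> Suc_connected k H'"
      if sub: "subgraph r H' H" and big: "real (card (verts H')) > c * real k + real k" for H'
    proof
      assume conn: "Suc_connected k H'"
      have E': "e \<subseteq> verts H'" "e \<in> edges H" "card e = r" if "e \<in> edges H'" for e
        using that sub by (auto simp: subgraph_def uniform_hypergraph_def)
      have "subgraph r H' H1 \<or> subgraph r H' H2"
        using Suc_connected_subgraph_side[OF sub conn sep card(1) fin(1)]
      proof
        assume V: "verts H' \<subseteq> S \<union> A"
        have "e \<in> edges H1" if "e \<in> edges H'" for e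
          using E'[OF that] V H1(2) by (auto simp: H_def N_def nonedges_def rsets_def)
        then show ?thesis using V H1(2) sub by (auto simp: subgraph_def)
      next
        assume V: "verts H' \<subseteq> S \<union> B"
        have "e \<in> edges H2" if "e \<in> edges H'" for e
          using E'[OF that] V H2(2) by (auto simp: H_def N_def nonedges_def rsets_def)
        then show ?thesis using V H2(2) sub by (auto simp: subgraph_def)
      qed
      then show False using H1(1) H2(1) big conn by (auto simp: family_def)
    qed
    moreover have "card (verts H) = a + b + k"
      using fin card disj by (simp add: H_def card_Un_disjoint Int_Un_distrib2)
    ultimately show ?thesis using U by (auto simp: family_def)
  qed
  then have "real ((a + b + k - k) choose r) - real (card (nonedges r H)) \<le> surplus c r (a + b + k) k"
    by (rule surplus_ge)
  moreover have "card (nonedges r H) \<le> card N"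
  proof (rule card_mono)
    show "finite N"
      unfolding N_def nonedges_def crossing_def using fin H1(2) H2(2) by (auto intro!: finite_rsets)
  qed (auto simp: nonedges_def H_def)
  moreover have "card N \<le> card (nonedges r H1) + card (nonedges r H2) + card (crossing r A B)"
    unfolding N_def by (meson add_le_mono1 card_Un_le le_trans)
  moreover have "card (crossing r A B) + (a choose r) + (b choose r) = (a + b) choose r"
    using card_crossing[OF fin(2,3) disj(3) assms(1)] card by simp
  ultimately show ?thesis using H1(3) H2(3) by simp
qed

section \<open>Splitting at a separator and the linear bound\<close>

text \<open>The reverse of gluing: the subgraphs induced on \<open>S \<union> A\<close> and
  \<open>S \<union> B\<close> stay in the family, and their non-edges together with the crossing
  sets are non-edges of \<open>H\<close>. The error term pays for what is counted twice.\<close>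

lemma surplus_split:
  assumes r: "0 < r" and m: "2 \<le> m" "c * real k < real m"
  obtains a b where "1 \<le> a" "1 \<le> b" "a + b = m"
    and "surplus c r (m + k) k
      \<le> surplus c r (a + k) k + surplus c r (b + k) k + real (k choose r)"
proof -
  obtain H where H: "H \<in> family c r (m + k) k"
    "surplus c r (m + k) k = real ((m + k - k) choose r) - real (card (nonedges r H))"
    by (rule surplus_attained)
  have U: "uniform_hypergraph r H" and cV: "card (verts H) = m + k"
    using H(1) by (auto simp: family_def)
  have "subgraph r H H" using U by (simp add: subgraph_def)
  \<comment> \<open>Here \<open>c * real k < real m\<close> makes \<open>H\<close> itself too large
    to be allowed as a highly connected subgraph. As \<open>2 \<le> m\<close> gives it
    \<open>k + 2\<close> vertices, it must have a separator.\<close>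
  then have "\<not> Suc_connected k H"
    using H(1) cV m unfolding family_def by force
  then obtain S A B where S: "card S = k" and sep: "separates H S A B"
    unfolding Suc_connected_iff[OF U] using cV m by auto
  have V: "verts H = S \<union> A \<union> B" and disj: "S \<inter> A = {}" "S \<inter> B = {}" "A \<inter> B = {}"
    and ne: "A \<noteq> {}" "B \<noteq> {}"
    and cross: "\<And>e. e \<in> edges H \<Longrightarrow> e \<inter> S = {} \<Longrightarrow> e \<subseteq> A \<or> e \<subseteq> B"
    using sep by (auto simp: separates_def)
  have fin: "finite S" "finite A" "finite B"
    using U V by (auto simp: uniform_hypergraph_def)
  have sum: "card A + card B = m"
    using cV V fin disj S by (simp add: card_Un_disjoint Int_Un_distrib2)
  define H' where "H' D = \<lparr>verts = S \<union> D, edges = {e \<in> edges H. e \<subseteq> S \<union> D}\<rparr>" for D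
  have sur: "real (card D choose r) - real (card (nonedges r (H' D))) \<le> surplus c r (card D + k) k"
    if "D \<subseteq> verts H" "finite D" "S \<inter> D = {}" for D
  proof -
    have "subgraph r (H' D) H"
      using U V that fin by (auto simp: subgraph_def uniform_hypergraph_def H'_def)
    moreover have "card (verts (H' D)) = card D + k"
      using that fin S by (simp add: H'_def card_Un_disjoint)
    ultimately have "H' D \<in> family c r (card D + k) k"
      using family_subgraph[OF H(1)] by metis
    from surplus_ge[OF this] show ?thesis by simp
  qed
  let ?N1 = "nonedges r (H' A)" and ?N2 = "nonedges r (H' B)" and ?C = "crossing r A B"
  have finN: "finite ?N1" "finite ?N2" "finite ?C" "finite (nonedges r H)"
    using fin V by (auto simp: nonedges_def crossing_def H'_def intro!: finite_rsets)
  \<comment> \<open>The two induced subgraphs share only the vertices of \<open>S\<close>; this is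
    the source of \<open>k choose r\<close>.\<close>
  have "?N1 \<inter> ?N2 \<subseteq> rsets r S"
    using disj by (auto simp: nonedges_def rsets_def H'_def)
  then have "card (?N1 \<inter> ?N2) \<le> k choose r"
    using fin(1) S by (metis card_mono card_rsets finite_rsets)
  moreover have "card ?N1 + card ?N2 = card (?N1 \<union> ?N2) + card (?N1 \<inter> ?N2)"
    using finN by (intro card_Un_Int)
  moreover have "card (?N1 \<union> ?N2 \<union> ?C) = card (?N1 \<union> ?N2) + card ?C"
  proof (rule card_Un_disjoint)
    have "e \<notin> ?C" if "e \<subseteq> S \<union> D" "D = A \<or> D = B" for e D
      using that disj by (auto simp: crossing_def rsets_def)
    then show "(?N1 \<union> ?N2) \<inter> ?C = {}"
      by (auto simp: nonedges_def rsets_def H'_def)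
  qed (use finN in auto)
  moreover have "card (?N1 \<union> ?N2 \<union> ?C) \<le> card (nonedges r H)"
  proof (rule card_mono[OF finN(4)])
    \<comment> \<open>Crossing sets miss \<open>S\<close>, so the separation would confine such an
      edge to one side.\<close>
    have "e \<inter> S = {}" if "e \<in> ?C" for e
      using that disj unfolding crossing_def rsets_def by blast
    then have "e \<subseteq> A \<or> e \<subseteq> B" if "e \<in> ?C" "e \<in> edges H" for e
      using cross that by blast
    then have "e \<notin> edges H" if "e \<in> ?C" for e
      using that by (auto simp: crossing_def rsets_def)
    moreover have "?C \<subseteq> rsets r (verts H)"
      using V by (auto simp: crossing_def rsets_def)
    ultimately have "?C \<subseteq> nonedges r H"
      unfolding nonedges_def by blast
    then show "?N1 \<union> ?N2 \<union> ?C \<subseteq> nonedges r H"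
      using V by (auto simp: rsets_def nonedges_def H'_def)
  qed
  moreover have "card ?C + (card A choose r) + (card B choose r) = m choose r"
    using card_crossing[OF fin(2,3) disj(3) r] sum by simp
  moreover have "real (card A choose r) - real (card ?N1) \<le> surplus c r (card A + k) k"
    and "real (card B choose r) - real (card ?N2) \<le> surplus c r (card B + k) k"
    using V fin disj by (auto intro!: sur)
  ultimately have "surplus c r (m + k) k
      \<le> surplus c r (card A + k) k + surplus c r (card B + k) k + real (k choose r)"
    using H(2) by simp
  moreover have "1 \<le> card A" "1 \<le> card B" using fin ne by (auto simp: Suc_le_eq card_gt_0_iff)
  ultimately show ?thesis using that sum by blast
qed

text \<open>Adding \<open>k choose r\<close> absorbs the error term of the split and gives
  \<open>G m \<le> G a + G b\<close>, so a linear bound passes from smaller arguments to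
  \<open>m\<close> by induction.\<close>

lemma surplus_linear_bound:
  assumes r: "0 < r"
  obtains D where "\<And>m. 1 \<le> m \<Longrightarrow> surplus c r (m + k) k \<le> D * real m"
proof -
  define G where "G m = surplus c r (m + k) k + real (k choose r)" for m
  \<comment> \<open>Every \<open>m\<close> beyond \<open>m0\<close> satisfies both conditions of
    \<open>surplus_split\<close>: the \<open>1\<close> gives \<open>2 \<le> m\<close>, the ceiling
    gives \<open>c * real k < real m\<close>.\<close>
  define m0 where "m0 = max 1 (nat \<lceil>c * real k\<rceil>)"
  \<comment> \<open>A sum of absolute values dominates each base value \<open>G i\<close> and is
    nonnegative, so \<open>D \<le> D * real m\<close> in the base case.\<close>
  define D where "D = (\<Sum>i = 1..m0. \<bar>G i\<bar>)"
  have "G m \<le> D * real m" if "1 \<le> m" for m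
    using that
  proof (induction m rule: less_induct)
    case (less m)
    show ?case
    proof (cases "m \<le> m0")
      case True
      have "G m \<le> \<bar>G m\<bar>" by simp
      also have "\<dots> \<le> D"
        unfolding D_def using less.prems True by (intro member_le_sum) auto
      also have "\<dots> \<le> D * real m"
        using less.prems by (intro mult_le_cancel_left1[THEN iffD2]) (auto simp: D_def sum_nonneg leD)
      finally show ?thesis .
    next
      case False
      then have "2 \<le> m" "c * real k < real m" unfolding m0_def by linarith+
      then obtain a b where ab: "1 \<le> a" "1 \<le> b" "a + b = m"
        "surplus c r (m + k) k \<le> surplus c r (a + k) k + surplus c r (b + k) k + real (k choose r)"
        using surplus_split[OF r] by metis
      have "G m \<le> G a + G b" using ab(4) by (simp add: G_def)
      also have "\<dots> \<le> D * real a + D * real b"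
        using less.IH[of a] less.IH[of b] ab by (intro add_mono) auto
      also have "\<dots> = D * real m" using ab(3) by (simp flip: distrib_left of_nat_add)
      finally show ?thesis .
    qed
  qed
  then have "surplus c r (m + k) k \<le> D * real m" if "1 \<le> m" for m
    using that by (fastforce simp: G_def)
  then show ?thesis by (rule that)
qed

section \<open>Convergence of the relative surplus\<close>

theorem theorem1p2:
  fixes k r :: nat and c :: real
  assumes "2 \<le> r" and "r \<le> k" and "0 \<le> c"
  shows "convergent (\<lambda>n. relative_surplus c r n k)"
proof -
  have r: "0 < r" using assms(1) by simp
  obtain D where "\<And>m. 1 \<le> m \<Longrightarrow> surplus c r (m + k) k \<le> D * real m"
    using surplus_linear_bound[OF r] by metis
  then have "convergent (\<lambda>m. surplus c r (m + k) k / real m)"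
    using surplus_superadditive[OF r] by (intro convergent_superadditive_div) auto
  then have "convergent (\<lambda>m. fact r / real k ^ (r - 1) * (surplus c r (m + k) k / real m))"
    by (intro convergent_mult convergent_const)
  \<comment> \<open>At \<open>n = m + k\<close> the denominator \<open>n - k\<close> is
    \<open>m\<close>, so the relative surplus is a fixed multiple of the Fekete quotient; the shift
    by \<open>k\<close> does not affect convergence.\<close>
  also have "(\<lambda>m. fact r / real k ^ (r - 1) * (surplus c r (m + k) k / real m))
      = (\<lambda>m. relative_surplus c r (m + k) k)"
    by (simp add: relative_surplus_def)
  finally show ?thesis
    using convergent_ignore_initial_segment by blast
qed

end
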